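(* Let $\eta\in L^\infty_+(\Omega)$. The sequence $\{\tau_n(\eta)\}_{n\in\mathbb{N}}$ is monotone decreasing (that is, $\tau_n(\eta)\ge\tau_{n+1}(\eta)$ for every $n\in\mathbb{N}$) and $\lim_{n\to+\infty}\tau_n(\eta)=0$.
   Context: $\Omega\subset\mathbb{R}^3$ is an open bounded domain with Lipschitz boundary and outer unit normal $\hat{\mathbf n}$. $\langle \mathbf u,\mathbf v\rangle=\int_\Omega \mathbf u\cdot\mathbf v\,\mathrm dV$ is the $L^2(\Omega;\mathbb{R}^3)$ inner product. $L^\infty_+(\Omega)$ is the set of $\theta\in L^\infty(\Omega)$ such that $\theta\ge c_0$ a.e. in $\Omega$ for some constant $c_0>0$. $H_L(\Omega)$ is the space of $\mathbf v\in L^2(\Omega;\mathbb{R}^3)$ with $\operatorname{div}\mathbf v=0$ in $\Omega$ and $\mathbf v\cdot\hat{\mathbf n}=0$ on $\partial\Omega$ (normal trace in the weak sense). The operator $A:H_L(\Omega)\to L^2(\Omega;\mathbb{R}^3)$ is $(A\mathbf v)(x)=\frac{\mu_0}{4\pi}\int_\Omega\frac{\mathbf v(x')}{\|x-x'\|}\,\mathrm dV(x')$ with $\mu_0>0$ a constant; it is compact, self-adjoint and positive definite. For $\eta\in L^\infty_+(\Omega)$ put $\|\mathbf v\|_\eta=\sqrt{\langle \eta\mathbf v,\mathbf v\rangle}$. The eigenvalues $\tau_n(\eta)$, $n=1,2,\dots$, of the generalized problem $\langle A\mathbf j,\mathbf w\rangle=\tau\langle\eta\mathbf j,\mathbf w\rangle$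 for all $\mathbf w\in H_L(\Omega)$ are defined, together with eigenfunctions $\mathbf j_n$, inductively by $$\tau_n(\eta)=\max\{\langle A\mathbf j,\mathbf j\rangle : \mathbf j\in H_L^n(\Omega),\ \|\mathbf j\|_\eta=1\},$$ where $H_L^1(\Omega)=H_L(\Omega)$, $H_L^n(\Omega)=\{\mathbf v\in H_L(\Omega): \langle \mathbf v,\eta\mathbf j_1\rangle=\dots=\langle\mathbf v,\eta\mathbf j_{n-1}\rangle=0\}$ for $n\ge2$, and $\mathbf j_n$ is a chosen maximizer at step $n$. *)

theory Defs
  imports "HOL-Analysis.Analysis"
begin

text \<open>
  Elements of \<open>L\<^sup>2\<close>, \<open>L\<^sup>\<infinity>\<close> and their subspaces are represented by Lebesgue measurable functions
  rather than by almost-everywhere classes; every notion below is invariant under changes on null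
  sets.
\<close>

subsection \<open>Bounded Lipschitz domains\<close>

text \<open>Near each boundary point, after an orthogonal change of coordinates \<open>T\<close>, the set is the
  region strictly above the graph of a Lipschitz function of two variables.\<close>

definition lipschitz_boundary :: "(real^3) set \<Rightarrow> bool" where
  "lipschitz_boundary \<Omega> \<longleftrightarrow>
     (\<forall>p\<in>frontier \<Omega>. \<exists>r>0. \<exists>T :: real^3 \<Rightarrow> real^3. \<exists>\<gamma> :: real \<times> real \<Rightarrow> real. \<exists>L.
        orthogonal_transformation T \<and> L-lipschitz_on UNIV \<gamma> \<and>
        (\<forall>x\<in>ball p r. x \<in> \<Omega> \<longleftrightarrow> T x $ 3 > \<gamma> (T x $ 1, T x $ 2)))"

definition bounded_lipschitz_domain :: "(real^3) set \<Rightarrow> bool" where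
  "bounded_lipschitz_domain \<Omega> \<longleftrightarrow>
     open \<Omega> \<and> connected \<Omega> \<and> \<Omega> \<noteq> {} \<and> bounded \<Omega> \<and> lipschitz_boundary \<Omega>"

subsection \<open>Lebesgue spaces\<close>

definition L2 :: "(real^3) set \<Rightarrow> (real^3 \<Rightarrow> 'b::euclidean_space) set" where
  "L2 \<Omega> = {v \<in> borel_measurable (lebesgue_on \<Omega>). integrable (lebesgue_on \<Omega>) (\<lambda>x. (norm (v x))\<^sup>2)}"

definition L2_inner ::
  "(real^3) set \<Rightarrow> (real^3 \<Rightarrow> 'b::euclidean_space) \<Rightarrow> (real^3 \<Rightarrow> 'b) \<Rightarrow> real" where
  "L2_inner \<Omega> u v = (LINT x|lebesgue_on \<Omega>. u x \<bullet> v x)"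

definition Linf_plus :: "(real^3) set \<Rightarrow> (real^3 \<Rightarrow> real) set" where
  "Linf_plus \<Omega> = {\<theta> \<in> borel_measurable (lebesgue_on \<Omega>).
     (\<exists>C. AE x in lebesgue_on \<Omega>. \<bar>\<theta> x\<bar> \<le> C) \<and>
     (\<exists>c0>0. AE x in lebesgue_on \<Omega>. \<theta> x \<ge> c0)}"

subsection \<open>Weak derivatives and the weak normal trace\<close>

definition grad :: "(real^3 \<Rightarrow> real) \<Rightarrow> real^3 \<Rightarrow> real^3" where
  "grad f x = (\<chi> i. frechet_derivative f (at x) (axis i 1))"

primrec C_k :: "nat \<Rightarrow> (real^3 \<Rightarrow> real) \<Rightarrow> bool" where
  "C_k 0 f \<longleftrightarrow> continuous_on UNIV f"
| "C_k (Suc k) f \<longleftrightarrow> (\<forall>x. f differentiable (at x)) \<and> (\<forall>i. C_k k (\<lambda>x. grad f x $ i))"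

text \<open>The space \<open>C\<^sub>c\<^sup>\<infinity>(\<Omega>)\<close>, with functions extended by zero to the whole space.\<close>

definition test_functions :: "(real^3) set \<Rightarrow> (real^3 \<Rightarrow> real) set" where
  "test_functions \<Omega> = {\<phi>. (\<forall>k. C_k k \<phi>) \<and>
     compact (closure {x. \<phi> x \<noteq> 0}) \<and> closure {x. \<phi> x \<noteq> 0} \<subseteq> \<Omega>}"

definition has_weak_div :: "(real^3) set \<Rightarrow> (real^3 \<Rightarrow> real^3) \<Rightarrow> (real^3 \<Rightarrow> real) \<Rightarrow> bool" where
  "has_weak_div \<Omega> v d \<longleftrightarrow> (\<forall>\<phi>\<in>test_functions \<Omega>. L2_inner \<Omega> v (grad \<phi>) = - L2_inner \<Omega> d \<phi>)"

definition has_weak_grad :: "(real^3) set \<Rightarrow> (real^3 \<Rightarrow> real) \<Rightarrow> (real^3 \<Rightarrow> real^3) \<Rightarrow> bool" where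
  "has_weak_grad \<Omega> u G \<longleftrightarrow> (\<forall>\<phi>\<in>test_functions \<Omega>. \<forall>i.
     L2_inner \<Omega> u (\<lambda>x. grad \<phi> x $ i) = - L2_inner \<Omega> (\<lambda>x. G x $ i) \<phi>)"

text \<open>For \<open>v \<in> L\<^sup>2\<close> with \<open>d = div v \<in> L\<^sup>2\<close>, the weak normal trace of \<open>v\<close> on the boundary is, by Green's
  formula, the functional \<open>u \<mapsto> \<langle>v, \<nabla>u\<rangle> + \<langle>div v, u\<rangle>\<close> on the Sobolev space \<open>H\<^sup>1(\<Omega>)\<close>.  Here \<open>u\<close> with
  its weak gradient \<open>G\<close> ranges over \<open>H\<^sup>1(\<Omega>)\<close>.\<close>

definition zero_normal_trace :: "(real^3) set \<Rightarrow> (real^3 \<Rightarrow> real^3) \<Rightarrow> bool" where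
  "zero_normal_trace \<Omega> v \<longleftrightarrow> (\<exists>d\<in>L2 \<Omega>. has_weak_div \<Omega> v d \<and>
     (\<forall>u\<in>L2 \<Omega>. \<forall>G\<in>L2 \<Omega>. has_weak_grad \<Omega> u G \<longrightarrow> L2_inner \<Omega> v G + L2_inner \<Omega> d u = 0))"

definition H_L :: "(real^3) set \<Rightarrow> (real^3 \<Rightarrow> real^3) set" where
  "H_L \<Omega> = {v \<in> L2 \<Omega>. has_weak_div \<Omega> v (\<lambda>x. 0) \<and> zero_normal_trace \<Omega> v}"

subsection \<open>The operator and its generalized eigenvalues\<close>

definition A_op :: "real \<Rightarrow> (real^3) set \<Rightarrow> (real^3 \<Rightarrow> real^3) \<Rightarrow> real^3 \<Rightarrow> real^3" where
  "A_op \<mu>0 \<Omega> v x = (\<mu>0 / (4 * pi)) *\<^sub>R (LINT x'|lebesgue_on \<Omega>. (1 / norm (x - x')) *\<^sub>R v x')"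

definition eta_norm :: "(real^3) set \<Rightarrow> (real^3 \<Rightarrow> real) \<Rightarrow> (real^3 \<Rightarrow> real^3) \<Rightarrow> real" where
  "eta_norm \<Omega> \<eta> v = sqrt (L2_inner \<Omega> (\<lambda>x. \<eta> x *\<^sub>R v x) v)"

definition H_L_n ::
  "(real^3) set \<Rightarrow> (real^3 \<Rightarrow> real) \<Rightarrow> (nat \<Rightarrow> real^3 \<Rightarrow> real^3) \<Rightarrow> nat \<Rightarrow> (real^3 \<Rightarrow> real^3) set" where
  "H_L_n \<Omega> \<eta> j n = {v \<in> H_L \<Omega>. \<forall>k\<in>{1..<n}. L2_inner \<Omega> v (\<lambda>x. \<eta> x *\<^sub>R j k x) = 0}"

text \<open>\<open>\<tau>\<close> and \<open>j\<close> arise from the inductive maximization, for some choice of a maximizer at each step.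
  Indices start at 1; the values of \<open>\<tau>\<close> and \<open>j\<close> at 0 are irrelevant.\<close>

definition eigen_sequence ::
  "real \<Rightarrow> (real^3) set \<Rightarrow> (real^3 \<Rightarrow> real) \<Rightarrow> (nat \<Rightarrow> real) \<Rightarrow> (nat \<Rightarrow> real^3 \<Rightarrow> real^3) \<Rightarrow> bool" where
  "eigen_sequence \<mu>0 \<Omega> \<eta> \<tau> j \<longleftrightarrow> (\<forall>n\<ge>1.
     is_arg_max (\<lambda>v. L2_inner \<Omega> (A_op \<mu>0 \<Omega> v) v)
       (\<lambda>v. v \<in> H_L_n \<Omega> \<eta> j n \<and> eta_norm \<Omega> \<eta> v = 1) (j n) \<and>
     \<tau> n = L2_inner \<Omega> (A_op \<mu>0 \<Omega> (j n)) (j n))"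

end

theory Submission
  imports Defs
begin

text \<open>The maximizers \<open>j\<^sub>n\<close> are orthonormal for the weight \<open>\<eta>\<close>.  Since \<open>1 / \<parallel>x - x'\<parallel>\<^sup>2\<close> is locally
  integrable in dimension three, uniformly in \<open>x\<close>, Bessel's inequality applied to the kernel of \<open>A\<close>
  in the variable \<open>x'\<close> bounds \<open>\<Sum>n. \<parallel>(A j\<^sub>n) x\<parallel>\<^sup>2\<close> uniformly in \<open>x\<close>.  Integrating over the bounded
  domain shows that \<open>\<Sum>n. \<tau>\<^sub>n\<^sup>2\<close> is finite: the compactness of \<open>A\<close> enters as a
  Hilbert--Schmidt bound.\<close>

subsection \<open>Bessel's inequality for square-integrable functions\<close>

lemma integrable_inner_square_integrable:
  fixes f g :: "'a \<Rightarrow> 'b::euclidean_space"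
  assumes [measurable]: "f \<in> borel_measurable M" "g \<in> borel_measurable M"
    and "integrable M (\<lambda>x. (norm (f x))\<^sup>2)" "integrable M (\<lambda>x. (norm (g x))\<^sup>2)"
  shows "integrable M (\<lambda>x. f x \<bullet> g x)"
proof (rule Bochner_Integration.integrable_bound)
  show "integrable M (\<lambda>x. (norm (f x))\<^sup>2 + (norm (g x))\<^sup>2)"
    using assms by simp
  have "\<bar>f x \<bullet> g x\<bar> \<le> (norm (f x))\<^sup>2 + (norm (g x))\<^sup>2" for x
    using Cauchy_Schwarz_ineq2[of "f x" "g x"] sum_squares_bound[of "norm (f x)" "norm (g x)"]
      mult_nonneg_nonneg[OF norm_ge_zero norm_ge_zero, of "f x" "g x"]
    by linarith
  then show "AE x in M. norm (f x \<bullet> g x) \<le> norm ((norm (f x))\<^sup>2 + (norm (g x))\<^sup>2)"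
    by simp
qed measurable

lemma integrable_scaleR_square_integrable:
  fixes f :: "'a \<Rightarrow> 'b::euclidean_space" and k :: "'a \<Rightarrow> real"
  assumes [measurable]: "k \<in> borel_measurable M" "f \<in> borel_measurable M"
    and "integrable M (\<lambda>x. (k x)\<^sup>2)" "integrable M (\<lambda>x. (norm (f x))\<^sup>2)"
  shows "integrable M (\<lambda>x. k x *\<^sub>R f x)"
proof (rule Bochner_Integration.integrable_bound)
  show "integrable M (\<lambda>x. \<bar>k x\<bar> \<bullet> norm (f x))"
    using assms by (intro integrable_inner_square_integrable) auto
qed auto

text \<open>Expanding the nonnegative integral of the squared distance from \<open>g\<close> to its
  projection on the span of the \<open>f n\<close> gives the bound. Working with functions rather
  than classes makes the integrability of every mixed product an explicit obligation.\<close>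

lemma bessel_inequality_integral:
  fixes f :: "nat \<Rightarrow> 'a \<Rightarrow> 'b::euclidean_space" and g :: "'a \<Rightarrow> 'b"
  assumes I: "finite I"
    and [measurable]: "g \<in> borel_measurable M" "\<And>n. n \<in> I \<Longrightarrow> f n \<in> borel_measurable M"
    and g: "integrable M (\<lambda>x. (norm (g x))\<^sup>2)"
    and f: "\<And>n. n \<in> I \<Longrightarrow> integrable M (\<lambda>x. (norm (f n x))\<^sup>2)"
    and orth: "\<And>m n. m \<in> I \<Longrightarrow> n \<in> I \<Longrightarrow>
      (LINT x|M. f m x \<bullet> f n x) = (if m = n then 1 else 0)"
  shows "(\<Sum>n\<in>I. (LINT x|M. g x \<bullet> f n x)\<^sup>2) \<le> (LINT x|M. (norm (g x))\<^sup>2)"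
proof -
  define c where "c n = (LINT x|M. g x \<bullet> f n x)" for n
  have gf: "integrable M (\<lambda>x. g x \<bullet> f n x)" if "n \<in> I" for n
    using that g f by (intro integrable_inner_square_integrable) auto
  have ff: "integrable M (\<lambda>x. f m x \<bullet> f n x)" if "m \<in> I" "n \<in> I" for m n
    using that f by (intro integrable_inner_square_integrable) auto
  have "0 \<le> (LINT x|M. (norm (g x - (\<Sum>n\<in>I. c n *\<^sub>R f n x)))\<^sup>2)"
    by (rule Bochner_Integration.integral_nonneg) (rule zero_le_power2)
  \<comment> \<open>Expanding pointwise first leaves finite sums of integrable products, to which
    linearity of the integral applies.\<close>
  also have "(\<lambda>x. (norm (g x - (\<Sum>n\<in>I. c n *\<^sub>R f n x)))\<^sup>2) =
      (\<lambda>x. (norm (g x))\<^sup>2 - 2 * (\<Sum>n\<in>I. c n * (g x \<bullet> f n x)) +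
        (\<Sum>m\<in>I. \<Sum>n\<in>I. c m * (c n * (f n x \<bullet> f m x))))"
  proof
    fix x
    have sq: "(norm (g x - s))\<^sup>2 = (norm (g x))\<^sup>2 - 2 * (g x \<bullet> s) + s \<bullet> s" for s
      by (simp only: power2_norm_eq_inner inner_diff_left inner_diff_right inner_commute[of s "g x"])
    show "(norm (g x - (\<Sum>n\<in>I. c n *\<^sub>R f n x)))\<^sup>2 =
      (norm (g x))\<^sup>2 - 2 * (\<Sum>n\<in>I. c n * (g x \<bullet> f n x)) +
        (\<Sum>m\<in>I. \<Sum>n\<in>I. c m * (c n * (f n x \<bullet> f m x)))"
      unfolding sq by (simp only: inner_sum_left inner_sum_right inner_scaleR_left
          inner_scaleR_right sum_distrib_left)
  qed
  also have "(LINT x|M. \<dots> x) = (LINT x|M. (norm (g x))\<^sup>2) - 2 * (\<Sum>n\<in>I. c n * c n) +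
      (\<Sum>m\<in>I. \<Sum>n\<in>I. c m * (c n * (if n = m then 1 else 0)))"
    using g gf ff by (simp add: orth c_def)
  \<comment> \<open>The double sum collapses to its diagonal and cancels half of the mixed
    term.\<close>
  also have "\<dots> = (LINT x|M. (norm (g x))\<^sup>2) - (\<Sum>n\<in>I. (c n)\<^sup>2)"
    using I by (simp add: if_distrib power2_eq_square sum.delta' cong: if_cong)
  finally show ?thesis
    by (simp add: c_def)
qed

subsection \<open>Integral operators with square-integrable kernel\<close>

text \<open>Moving \<open>sqrt (w x)\<close> onto \<open>f n\<close> and its inverse onto
  \<open>g\<close> makes the family orthonormal without weight and keeps the pairings. The price is
  the norm of \<open>g x / sqrt (w x)\<close>, whence the factor \<open>1 / c\<close>.\<close>

lemma weighted_orthonormal_bessel: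
  fixes f :: "nat \<Rightarrow> 'a \<Rightarrow> 'b::euclidean_space" and g :: "'a \<Rightarrow> 'b"
  assumes I: "finite I"
    and [measurable]: "w \<in> borel_measurable M" "g \<in> borel_measurable M"
      "\<And>n. n \<in> I \<Longrightarrow> f n \<in> borel_measurable M"
    and g: "integrable M (\<lambda>x. (norm (g x))\<^sup>2)"
    and c: "0 < c" and w: "AE x in M. c \<le> w x"
    and f: "\<And>n. n \<in> I \<Longrightarrow> integrable M (\<lambda>x. w x * (norm (f n x))\<^sup>2)"
    and orth: "\<And>m n. m \<in> I \<Longrightarrow> n \<in> I \<Longrightarrow>
      (LINT x|M. w x * (f m x \<bullet> f n x)) = (if m = n then 1 else 0)"
  shows "(\<Sum>n\<in>I. (LINT x|M. g x \<bullet> f n x)\<^sup>2) \<le> (LINT x|M. (norm (g x))\<^sup>2) / c"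
proof -
  define G where "G x = (1 / sqrt (w x)) *\<^sub>R g x" for x
  define F where "F n x = sqrt (w x) *\<^sub>R f n x" for n x
  have [measurable]: "G \<in> borel_measurable M" "\<And>n. n \<in> I \<Longrightarrow> F n \<in> borel_measurable M"
    unfolding G_def F_def by measurable
  \<comment> \<open>Cancelling the square roots requires \<open>w x > 0\<close>, which is known only
    almost everywhere; hence the AE forms from here on.\<close>
  have GF: "AE x in M. G x \<bullet> F n x = g x \<bullet> f n x" for n
    using w by eventually_elim (use c in \<open>auto simp: G_def F_def\<close>)
  have FF: "AE x in M. F m x \<bullet> F n x = w x * (f m x \<bullet> f n x)" for m n
    using w by eventually_elim (use c in \<open>auto simp: F_def\<close>)
  have F2: "AE x in M. (norm (F n x))\<^sup>2 = w x * (norm (f n x))\<^sup>2" for n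
    using w by eventually_elim (use c in \<open>auto simp: F_def power_mult_distrib\<close>)
  have Gle: "AE x in M. (norm (G x))\<^sup>2 \<le> (norm (g x))\<^sup>2 / c"
    using w
  proof eventually_elim
    case (elim x)
    then have "(norm (G x))\<^sup>2 = (norm (g x))\<^sup>2 / w x"
      using c by (simp add: G_def power_divide)
    also have "\<dots> \<le> (norm (g x))\<^sup>2 / c"
      using elim c by (intro divide_left_mono) auto
    finally show ?case .
  qed
  have G: "integrable M (\<lambda>x. (norm (G x))\<^sup>2)"
  proof (rule Bochner_Integration.integrable_bound)
    show "integrable M (\<lambda>x. (norm (g x))\<^sup>2 / c)"
      using g by simp
    show "AE x in M. norm ((norm (G x))\<^sup>2) \<le> norm ((norm (g x))\<^sup>2 / c)"
      using Gle by eventually_elim (use c in simp)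
  qed measurable
  have "(\<Sum>n\<in>I. (LINT x|M. G x \<bullet> F n x)\<^sup>2) \<le> (LINT x|M. (norm (G x))\<^sup>2)"
  proof (rule bessel_inequality_integral[OF I])
    show "integrable M (\<lambda>x. (norm (F n x))\<^sup>2)" if "n \<in> I" for n
      by (subst integrable_cong_AE[OF _ _ F2]) (use that f in auto)
    show "(LINT x|M. F m x \<bullet> F n x) = (if m = n then 1 else 0)" if "m \<in> I" "n \<in> I" for m n
      by (subst integral_cong_AE[OF _ _ FF]) (use that orth in auto)
  qed (use G in auto)
  also have "\<dots> \<le> (LINT x|M. (norm (g x))\<^sup>2 / c)"
    using G g Gle by (intro integral_mono_AE) auto
  also have "\<dots> = (LINT x|M. (norm (g x))\<^sup>2) / c"
    by simp
  also have "(\<Sum>n\<in>I. (LINT x|M. G x \<bullet> F n x)\<^sup>2) = (\<Sum>n\<in>I. (LINT x|M. g x \<bullet> f n x)\<^sup>2)"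
    by (intro sum.cong refl arg_cong[where f = "\<lambda>x. x\<^sup>2"] integral_cong_AE GF) auto
  finally show ?thesis .
qed

text \<open>Bessel is used twice, each time costing \<open>1 / c\<close>: over the whole family for
  each row \<open>k x\<close>, and for one index at a time to pass from the quadratic form to the
  norm of the image. The bound does not depend on the size of \<open>I\<close>.\<close>

lemma kernel_operator_quadratic_form_bound:
  fixes f :: "nat \<Rightarrow> 'a \<Rightarrow> 'b::euclidean_space" and k :: "'a \<Rightarrow> 'a \<Rightarrow> real"
  assumes M: "finite_measure M" and I: "finite I"
    and [measurable]: "w \<in> borel_measurable M"
      "\<And>n. n \<in> I \<Longrightarrow> f n \<in> borel_measurable M"
      "case_prod k \<in> borel_measurable (M \<Otimes>\<^sub>M M)"
    and k: "\<And>x. x \<in> space M \<Longrightarrow> integrable M (\<lambda>y. (k x y)\<^sup>2)"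
    and B: "\<And>x. x \<in> space M \<Longrightarrow> (LINT y|M. (k x y)\<^sup>2) \<le> B"
    and c: "0 < c" and w: "AE x in M. c \<le> w x"
    and f: "\<And>n. n \<in> I \<Longrightarrow> integrable M (\<lambda>x. w x * (norm (f n x))\<^sup>2)"
    and orth: "\<And>m n. m \<in> I \<Longrightarrow> n \<in> I \<Longrightarrow>
      (LINT x|M. w x * (f m x \<bullet> f n x)) = (if m = n then 1 else 0)"
  shows "(\<Sum>n\<in>I. (LINT x|M. (LINT y|M. k x y *\<^sub>R f n y) \<bullet> f n x)\<^sup>2)
    \<le> real DIM('b) * B / c\<^sup>2 * measure M (space M)"
proof -
  interpret finite_measure M by fact
  define T where "T n x = (LINT y|M. k x y *\<^sub>R f n y)" for n x
  define S where "S = real DIM('b) * (B / c)"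
  have [measurable]: "T n \<in> borel_measurable M" if [measurable]: "n \<in> I" for n
    unfolding T_def by measurable
  have f2: "integrable M (\<lambda>x. (norm (f n x))\<^sup>2)" if "n \<in> I" for n
  proof (rule Bochner_Integration.integrable_bound)
    show "integrable M (\<lambda>x. w x * (norm (f n x))\<^sup>2 / c)"
      using f[OF that] by simp
    show "AE x in M. norm ((norm (f n x))\<^sup>2) \<le> norm (w x * (norm (f n x))\<^sup>2 / c)"
      using w
    proof eventually_elim
      case (elim x)
      then have "c * (norm (f n x))\<^sup>2 \<le> w x * (norm (f n x))\<^sup>2"
        by (intro mult_right_mono) auto
      then show ?case
        using c elim by (simp add: field_simps)
    qed
  qed (use that in measurable)
  have T_sum: "(\<Sum>n\<in>I. (norm (T n x))\<^sup>2) \<le> S" if x: "x \<in> space M" for x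
  proof -
    have [measurable]: "k x \<in> borel_measurable M"
      using measurable_Pair2[OF \<open>case_prod k \<in> _\<close> x] by simp
    \<comment> \<open>Bessel concerns scalar pairings, so the vector \<open>T n x\<close> is split
      into coordinates: each one pairs \<open>f n\<close> with the row times a fixed basis vector.
      This produces the factor \<open>DIM('b)\<close>.\<close>
    have Tb: "T n x \<bullet> b = (LINT y|M. (k x y *\<^sub>R b) \<bullet> f n y)" if "n \<in> I" for n b
    proof -
      have "integrable M (\<lambda>y. k x y *\<^sub>R f n y)"
        using that k[OF x] f2 by (intro integrable_scaleR_square_integrable) auto
      from integral_inner_left[OF this, of b] show ?thesis
        by (simp add: T_def inner_commute)
    qed
    have "(norm (T n x))\<^sup>2 = (\<Sum>b\<in>Basis. (T n x \<bullet> b)\<^sup>2)" for n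
      unfolding power2_norm_eq_inner by (subst euclidean_inner) (simp add: power2_eq_square)
    then have "(\<Sum>n\<in>I. (norm (T n x))\<^sup>2) = (\<Sum>n\<in>I. \<Sum>b\<in>Basis. (T n x \<bullet> b)\<^sup>2)"
      by simp
    also have "\<dots> = (\<Sum>b\<in>Basis. \<Sum>n\<in>I. (LINT y|M. (k x y *\<^sub>R b) \<bullet> f n y)\<^sup>2)"
      by (subst sum.swap) (intro sum.cong refl; simp only: Tb)
    also have "\<dots> \<le> (\<Sum>b\<in>(Basis :: 'b set). B / c)"
    proof (rule sum_mono)
      fix b :: 'b assume b: "b \<in> Basis"
      have "(\<Sum>n\<in>I. (LINT y|M. (k x y *\<^sub>R b) \<bullet> f n y)\<^sup>2) \<le> (LINT y|M. (norm (k x y *\<^sub>R b))\<^sup>2) / c"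
        using k[OF x] b by (intro weighted_orthonormal_bessel[OF I _ _ _ _ c w f orth]) auto
      also have "\<dots> \<le> B / c"
        using B[OF x] b c by (intro divide_right_mono) auto
      finally show "(\<Sum>n\<in>I. (LINT y|M. (k x y *\<^sub>R b) \<bullet> f n y)\<^sup>2) \<le> B / c" .
    qed
    finally show ?thesis
      by (simp add: S_def)
  qed
  \<comment> \<open>A single term is at most the sum \<open>S\<close>, and constants are integrable
    because the measure is finite.\<close>
  have T2: "integrable M (\<lambda>x. (norm (T n x))\<^sup>2)" if "n \<in> I" for n
  proof (rule integrable_const_bound[where B = S])
    have "(norm (T n x))\<^sup>2 \<le> S" if "x \<in> space M" for x
      using member_le_sum[OF \<open>n \<in> I\<close>, of "\<lambda>n. (norm (T n x))\<^sup>2"] I T_sum[OF that] by simp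
    then show "AE x in M. norm ((norm (T n x))\<^sup>2) \<le> S"
      by (intro AE_I2) simp
  qed (use that in measurable)
  have "(\<Sum>n\<in>I. (LINT x|M. T n x \<bullet> f n x)\<^sup>2) \<le> (\<Sum>n\<in>I. (LINT x|M. (norm (T n x))\<^sup>2) / c)"
  proof (rule sum_mono)
    fix n assume n: "n \<in> I"
    \<comment> \<open>For a one-element family Bessel is the weighted Cauchy-Schwarz inequality with
      \<open>f n\<close> normalized.\<close>
    show "(LINT x|M. T n x \<bullet> f n x)\<^sup>2 \<le> (LINT x|M. (norm (T n x))\<^sup>2) / c"
      using weighted_orthonormal_bessel[of "{n}" w M "T n" f c] n T2[OF n] c w f orth by simp
  qed
  also have "\<dots> = (LINT x|M. (\<Sum>n\<in>I. (norm (T n x))\<^sup>2)) / c"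
    using T2 by (simp add: sum_divide_distrib)
  also have "\<dots> \<le> (LINT x|M. S) / c"
    using T2 T_sum c by (intro divide_right_mono integral_mono) auto
  also have "\<dots> = real DIM('b) * B / c\<^sup>2 * measure M (space M)"
    by (simp add: S_def power2_eq_square)
  finally show ?thesis
    by (simp add: T_def)
qed

subsection \<open>The Newtonian kernel\<close>

text \<open>The single term of the dyadic shell containing \<open>r\<close> already dominates. Using
  full intervals instead of shells enlarges the sum but turns its integral into a series of ball
  volumes, in place of polar coordinates.\<close>

lemma inverse_square_le_dyadic_sum:
  assumes "0 < r" "r < R"
  shows "ennreal (1 / r\<^sup>2) \<le>
    (\<Sum>i. ennreal (4 ^ Suc i / R\<^sup>2) * indicator {..<R / 2 ^ i} r)"
proof -
  have "\<exists>i. R / 2 ^ i \<le> r"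
  proof -
    obtain i where "R / r < 2 ^ i"
      using real_arch_pow[of 2 "R / r"] by auto
    then show ?thesis
      using assms by (intro exI[of _ i]) (simp add: field_simps)
  qed
  then obtain i where i: "R / 2 ^ i \<le> r" and least: "\<And>l. l < i \<Longrightarrow> r < R / 2 ^ l"
    using exists_least_iff[of "\<lambda>i. R / 2 ^ i \<le> r"] by (auto simp: not_le)
  \<comment> \<open>The least \<open>i\<close> is positive because \<open>r < R\<close>; its
    predecessor \<open>l\<close> satisfies \<open>R / 2 ^ Suc l \<le> r < R / 2 ^ l\<close>.\<close>
  with assms obtain l where l: "i = Suc l"
    by (cases i) auto
  have "R\<^sup>2 \<le> (2 ^ i * r)\<^sup>2"
    using i assms by (intro power_mono) (auto simp: field_simps)
  also have "\<dots> = 4 ^ Suc l * r\<^sup>2"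
    by (simp add: l power_mult_distrib power_even_eq[symmetric] power2_eq_square
        flip: power_mult_distrib)
  finally have "1 / r\<^sup>2 \<le> 4 ^ Suc l / R\<^sup>2"
    using assms by (simp add: field_simps)
  then have "ennreal (1 / r\<^sup>2) \<le> ennreal (4 ^ Suc l / R\<^sup>2) * indicator {..<R / 2 ^ l} r"
    using least[of l] l by (simp add: ennreal_leI)
  also have "\<dots> \<le> (\<Sum>i. ennreal (4 ^ Suc i / R\<^sup>2) * indicator {..<R / 2 ^ i} r)"
    using sum_le_suminf[of "\<lambda>i. ennreal (4 ^ Suc i / R\<^sup>2) * indicator {..<R / 2 ^ i} r" "{l}"]
    by (simp del: sum_ennreal power_Suc sum_mult_indicator)
  finally show ?thesis .
qed

text \<open>From one ball to the next the weight grows by 4 while the volume shrinks by 8, so the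
  series is geometric with ratio 1/2. Its first term \<open>4 * unit_ball_vol 3 * R\<close> doubles
  to the stated constant.\<close>

lemma nn_integral_inverse_square_dist_ball:
  fixes y :: "real^3"
  assumes R: "0 < R"
  shows "(\<integral>\<^sup>+x. ennreal (1 / (dist y x)\<^sup>2) * indicator (ball y R) x \<partial>lborel)
    \<le> ennreal (8 * unit_ball_vol 3 * R)"
proof -
  \<comment> \<open>At the singularity \<open>x = y\<close> the left side is 0, since division by
    zero yields 0; outside the ball the indicator vanishes.\<close>
  have "ennreal (1 / (dist y x)\<^sup>2) * indicator (ball y R) x \<le>
      (\<Sum>i. ennreal (4 ^ Suc i / R\<^sup>2) * indicator (ball y (R / 2 ^ i)) x)" for x
  proof (cases "y \<noteq> x \<and> dist y x < R")
    case True
    moreover have "indicator (ball y s) x = (indicator {..<s} (dist y x) :: ennreal)" for s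
      by (simp add: indicator_def)
    ultimately show ?thesis
      using inverse_square_le_dyadic_sum[of "dist y x" R] by (simp del: power_Suc)
  qed (auto simp: indicator_def)
  then have "(\<integral>\<^sup>+x. ennreal (1 / (dist y x)\<^sup>2) * indicator (ball y R) x \<partial>lborel)
      \<le> (\<integral>\<^sup>+x. (\<Sum>i. ennreal (4 ^ Suc i / R\<^sup>2) * indicator (ball y (R / 2 ^ i)) x) \<partial>lborel)"
    by (intro nn_integral_mono)
  also have "\<dots> = (\<Sum>i. \<integral>\<^sup>+x. ennreal (4 ^ Suc i / R\<^sup>2) * indicator (ball y (R / 2 ^ i)) x \<partial>lborel)"
    by (intro nn_integral_suminf borel_measurable_times_ennreal borel_measurable_const
        borel_measurable_indicator) simp
  also have "\<dots> = (\<Sum>i. ennreal (4 ^ Suc i / R\<^sup>2) * emeasure lborel (ball y (R / 2 ^ i)))"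
    by (simp add: nn_integral_cmult_indicator)
  also have "\<dots> = (\<Sum>i. ennreal (4 * unit_ball_vol 3 * R * (1 / 2) ^ i))"
  proof (rule suminf_cong)
    fix i
    have "(4::real) ^ i = 2 ^ i * 2 ^ i"
      by (simp flip: power_mult_distrib)
    then have "4 ^ Suc i / R\<^sup>2 * (unit_ball_vol 3 * (R / 2 ^ i) ^ 3)
        = 4 * unit_ball_vol 3 * R * (1 / 2) ^ i"
      using R by (simp add: field_simps power2_eq_square power3_eq_cube)
    then show "ennreal (4 ^ Suc i / R\<^sup>2) * emeasure lborel (ball y (R / 2 ^ i))
        = ennreal (4 * unit_ball_vol 3 * R * (1 / 2) ^ i)"
      using R by (simp add: emeasure_ball flip: ennreal_mult)
  qed
  also have "\<dots> = ennreal (8 * unit_ball_vol 3 * R)"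
  proof (rule suminf_ennreal_eq)
    have "(\<lambda>i. (4 * unit_ball_vol 3 * R) * (1 / 2) ^ i) sums ((4 * unit_ball_vol 3 * R) * (1 / (1 - 1 / 2)))"
      by (intro sums_mult geometric_sums) simp
    then show "(\<lambda>i. 4 * unit_ball_vol 3 * R * (1 / 2) ^ i) sums (8 * unit_ball_vol 3 * R)"
      by (simp add: mult.assoc)
  qed (use R in simp)
  finally show ?thesis .
qed

text \<open>The bound depends on \<open>y\<close> only through \<open>R\<close>, so a radius valid
  for all \<open>y\<close> gives a uniform bound on the kernel rows.\<close>

lemma newtonian_kernel_square_integrable:
  fixes \<Omega> :: "(real^3) set"
  assumes \<Omega>: "\<Omega> \<in> sets lebesgue" "\<Omega> \<subseteq> ball y R" and R: "0 < R"
  shows "integrable (lebesgue_on \<Omega>) (\<lambda>x. (1 / norm (y - x))\<^sup>2)" (is ?integrable)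
    and "(LINT x|lebesgue_on \<Omega>. (1 / norm (y - x))\<^sup>2) \<le> 8 * unit_ball_vol 3 * R" (is ?bound)
proof -
  have meas: "(\<lambda>x. (1 / norm (y - x))\<^sup>2) \<in> borel_measurable (lebesgue_on \<Omega>)"
    by (intro measurable_restrict_space1 measurable_completion) measurable
  have "(\<integral>\<^sup>+x. ennreal ((1 / norm (y - x))\<^sup>2) \<partial>lebesgue_on \<Omega>)
      = (\<integral>\<^sup>+x. ennreal ((1 / norm (y - x))\<^sup>2) * indicator \<Omega> x \<partial>lebesgue)"
    using \<Omega> by (simp add: nn_integral_restrict_space)
  also have "\<dots> \<le> (\<integral>\<^sup>+x. ennreal (1 / (dist y x)\<^sup>2) * indicator (ball y R) x \<partial>lebesgue)"
    using \<Omega> by (intro nn_integral_mono) (auto simp: indicator_def dist_norm power_divide)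
  also have "\<dots> = (\<integral>\<^sup>+x. ennreal (1 / (dist y x)\<^sup>2) * indicator (ball y R) x \<partial>lborel)"
    by (rule nn_integral_completion)
  also have "\<dots> \<le> ennreal (8 * unit_ball_vol 3 * R)"
    using R by (rule nn_integral_inverse_square_dist_ball)
  finally have le: "(\<integral>\<^sup>+x. ennreal ((1 / norm (y - x))\<^sup>2) \<partial>lebesgue_on \<Omega>)
      \<le> ennreal (8 * unit_ball_vol 3 * R)" .
  show ?integrable
    using meas le by (intro integrableI_nonneg) (auto intro: le_less_trans)
  have "0 \<le> 8 * unit_ball_vol 3 * R"
    using R by simp
  with le show ?bound
    using meas by (subst integral_eq_nn_integral) (auto intro: enn2real_leI)
qed

subsection \<open>Decay of the generalized eigenvalues\<close>

lemma Linf_plusE: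
  assumes "\<eta> \<in> Linf_plus \<Omega>"
  obtains C c where "\<eta> \<in> borel_measurable (lebesgue_on \<Omega>)"
    "AE x in lebesgue_on \<Omega>. \<bar>\<eta> x\<bar> \<le> C"
    "0 < c" "AE x in lebesgue_on \<Omega>. c \<le> \<eta> x"
  using assms by (auto simp: Linf_plus_def)

text \<open>The essential upper bound of \<open>\<eta>\<close> enters here: it keeps the weighted
  norms of \<open>L2\<close> functions finite.\<close>

lemma L2_Linf_plus_integrable:
  assumes "v \<in> L2 \<Omega>" "\<eta> \<in> Linf_plus \<Omega>"
  shows "integrable (lebesgue_on \<Omega>) (\<lambda>x. \<eta> x * (norm (v x))\<^sup>2)"
proof -
  obtain C where [measurable]: "\<eta> \<in> borel_measurable (lebesgue_on \<Omega>)"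
    and C: "AE x in lebesgue_on \<Omega>. \<bar>\<eta> x\<bar> \<le> C"
    using assms(2) by (rule Linf_plusE)
  have [measurable]: "v \<in> borel_measurable (lebesgue_on \<Omega>)"
    and v: "integrable (lebesgue_on \<Omega>) (\<lambda>x. (norm (v x))\<^sup>2)"
    using assms(1) by (auto simp: L2_def)
  show ?thesis
  proof (rule Bochner_Integration.integrable_bound)
    show "integrable (lebesgue_on \<Omega>) (\<lambda>x. C * (norm (v x))\<^sup>2)"
      using v by simp
    show "AE x in lebesgue_on \<Omega>. norm (\<eta> x * (norm (v x))\<^sup>2) \<le> norm (C * (norm (v x))\<^sup>2)"
      using C by eventually_elim (auto simp: abs_mult intro!: mult_right_mono)
  qed measurable
qed

lemma eigen_sequence_decreasing:
  assumes "eigen_sequence \<mu>0 \<Omega> \<eta> \<tau> j" "1 \<le> n"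
  shows "\<tau> (Suc n) \<le> \<tau> n"
proof -
  have "j (Suc n) \<in> H_L_n \<Omega> \<eta> j (Suc n)" "eta_norm \<Omega> \<eta> (j (Suc n)) = 1"
    using assms by (auto simp: eigen_sequence_def is_arg_max_def)
  \<comment> \<open>The constraint sets are nested, so the next maximizer already competes at step
    \<open>n\<close>.\<close>
  then have "j (Suc n) \<in> H_L_n \<Omega> \<eta> j n" "eta_norm \<Omega> \<eta> (j (Suc n)) = 1"
    by (auto simp: H_L_n_def)
  then show ?thesis
    using assms by (auto simp: eigen_sequence_def is_arg_max_def not_less)
qed

lemma eigen_sequence_orthonormal:
  assumes "eigen_sequence \<mu>0 \<Omega> \<eta> \<tau> j" "1 \<le> m" "1 \<le> n"
  shows "(LINT x|lebesgue_on \<Omega>. \<eta> x * (j m x \<bullet> j n x)) = (if m = n then 1 else 0)"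
proof -
  \<comment> \<open>The constraints pair a maximizer only with earlier ones; symmetry of the inner
    product supplies the other order.\<close>
  have orth: "(LINT x|lebesgue_on \<Omega>. \<eta> x * (j k x \<bullet> j l x)) = 0" if "1 \<le> k" "k < l" for k l
  proof -
    have "j l \<in> H_L_n \<Omega> \<eta> j l"
      using assms(1) that by (auto simp: eigen_sequence_def is_arg_max_def)
    then have "L2_inner \<Omega> (j l) (\<lambda>x. \<eta> x *\<^sub>R j k x) = 0"
      using that by (auto simp: H_L_n_def)
    then show ?thesis
      by (simp add: L2_inner_def inner_commute)
  qed
  have "eta_norm \<Omega> \<eta> (j n) = 1"
    using assms by (auto simp: eigen_sequence_def is_arg_max_def)
  then have "(LINT x|lebesgue_on \<Omega>. \<eta> x * (j n x \<bullet> j n x)) = 1"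
    by (simp add: eta_norm_def L2_inner_def)
  then show ?thesis
    using orth[of m n] orth[of n m] assms by (cases m n rule: linorder_cases) (auto simp: inner_commute)
qed

text \<open>Up to the factor \<open>\<mu>0 / (4 * pi)\<close>, each \<open>\<tau> n\<close> is the
  quadratic form of the Newtonian kernel at \<open>j n\<close>, so the kernel bound applies to any
  finite part of the family. The shift by \<open>Suc\<close> reflects that indices start at
  1.\<close>

lemma eigen_sequence_square_sums_bounded:
  fixes \<Omega> :: "(real^3) set"
  assumes \<Omega>: "open \<Omega>" "bounded \<Omega>" and \<eta>: "\<eta> \<in> Linf_plus \<Omega>"
    and eig: "eigen_sequence \<mu>0 \<Omega> \<eta> \<tau> j"
  obtains B where "\<And>N. (\<Sum>n<N. (\<tau> (Suc n))\<^sup>2) \<le> B"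
proof -
  let ?M = "lebesgue_on \<Omega>"
  obtain c where [measurable]: "\<eta> \<in> borel_measurable ?M"
    and c: "0 < c" "AE x in ?M. c \<le> \<eta> x"
    using \<eta> by (rule Linf_plusE)
  obtain r where r: "0 < r" "\<And>x. x \<in> \<Omega> \<Longrightarrow> norm x < r"
    using \<Omega>(2) by (auto simp: bounded_pos_less)
  \<comment> \<open>Two points of the domain are less than \<open>2 * r\<close> apart, so this one
    radius serves every row of the kernel.\<close>
  have ball: "\<Omega> \<subseteq> ball x (2 * r)" if "x \<in> \<Omega>" for x
  proof
    fix y assume "y \<in> \<Omega>"
    then show "y \<in> ball x (2 * r)"
      using r(2)[OF that] r(2)[of y] norm_triangle_ineq4[of x y] by (simp add: dist_norm)
  qed
  have sets: "\<Omega> \<in> sets lebesgue"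
    using \<Omega>(1) by simp
  have fin: "finite_measure ?M"
    using \<Omega> by (intro finite_measure_lebesgue_on bounded_set_imp_lmeasurable) auto
  have id: "(\<lambda>x. x) \<in> measurable ?M borel"
    by (intro measurable_restrict_space1 measurable_completion) simp
  have kernel: "(\<lambda>(x, y). 1 / norm (x - y)) \<in> borel_measurable (?M \<Otimes>\<^sub>M ?M)"
  proof -
    \<comment> \<open>Composing the projections with the identity from Lebesgue to Borel sets makes
      the kernel a Borel function of measurable maps.\<close>
    have [measurable]: "fst \<in> measurable (?M \<Otimes>\<^sub>M ?M) borel" "snd \<in> measurable (?M \<Otimes>\<^sub>M ?M) borel"
      using measurable_compose[OF measurable_fst id] measurable_compose[OF measurable_snd id] by auto
    show ?thesis
      by measurable
  qed
  have j: "j n \<in> L2 \<Omega>" if "1 \<le> n" for n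
    using eig that by (auto simp: eigen_sequence_def is_arg_max_def H_L_n_def H_L_def)
  define B where "B = real DIM(real^3) * (8 * unit_ball_vol 3 * (2 * r)) / c\<^sup>2 * measure ?M (space ?M)"
  have \<tau>: "\<tau> n = \<mu>0 / (4 * pi) *
      (LINT x|?M. (LINT y|?M. (1 / norm (x - y)) *\<^sub>R j n y) \<bullet> j n x)" if "1 \<le> n" for n
    using eig that by (simp add: eigen_sequence_def L2_inner_def A_op_def)
  have "(\<Sum>n<N. (\<tau> (Suc n))\<^sup>2) \<le> (\<mu>0 / (4 * pi))\<^sup>2 * B" for N
  proof -
    have "(\<Sum>n<N. (LINT x|?M. (LINT y|?M. (1 / norm (x - y)) *\<^sub>R j (Suc n) y) \<bullet> j (Suc n) x)\<^sup>2) \<le> B"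
      unfolding B_def
    proof (rule kernel_operator_quadratic_form_bound[OF fin _ _ _ kernel _ _ c])
      show "j (Suc n) \<in> borel_measurable ?M" for n
        using j[of "Suc n"] by (simp add: L2_def)
      show "integrable ?M (\<lambda>x. \<eta> x * (norm (j (Suc n) x))\<^sup>2)" for n
        using j \<eta> by (intro L2_Linf_plus_integrable) auto
      show "(LINT x|?M. \<eta> x * (j (Suc m) x \<bullet> j (Suc n) x)) = (if m = n then 1 else 0)" for m n
        using eigen_sequence_orthonormal[OF eig, of "Suc m" "Suc n"] by simp
    qed (use newtonian_kernel_square_integrable[OF sets ball] r in auto)
    then show ?thesis
      by (simp only: \<tau> power_mult_distrib le_add1 plus_1_eq_Suc[symmetric] flip: sum_distrib_left)
        (intro mult_left_mono; simp)
  qed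
  then show thesis
    by (rule that)
qed

theorem proposition3p4:
  fixes \<Omega> :: "(real^3) set" and \<mu>0 :: real and \<eta> :: "real^3 \<Rightarrow> real"
    and \<tau> :: "nat \<Rightarrow> real" and j :: "nat \<Rightarrow> real^3 \<Rightarrow> real^3"
  assumes "bounded_lipschitz_domain \<Omega>"
    and "\<mu>0 > 0"
    and "\<eta> \<in> Linf_plus \<Omega>"
    and "eigen_sequence \<mu>0 \<Omega> \<eta> \<tau> j"
  shows "(\<forall>n\<ge>1. \<tau> n \<ge> \<tau> (Suc n)) \<and> \<tau> \<longlonglongrightarrow> 0"
proof
  show "\<forall>n\<ge>1. \<tau> n \<ge> \<tau> (Suc n)"
    using eigen_sequence_decreasing[OF assms(4)] by blast
  obtain B where B: "\<And>N. (\<Sum>n<N. (\<tau> (Suc n))\<^sup>2) \<le> B"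
    using assms by (auto simp: bounded_lipschitz_domain_def
        intro: eigen_sequence_square_sums_bounded)
  \<comment> \<open>Bounded partial sums of squares force the squares to 0; the square root then
    gives the absolute values, and the last step restores the irrelevant index 0.\<close>
  have "summable (\<lambda>n. (\<tau> (Suc n))\<^sup>2)"
    by (rule summableI_nonneg_bounded[OF _ B]) simp
  then have "(\<lambda>n. sqrt ((\<tau> (Suc n))\<^sup>2)) \<longlonglongrightarrow> sqrt 0"
    by (intro tendsto_real_sqrt summable_LIMSEQ_zero)
  then have "(\<lambda>n. \<tau> (Suc n)) \<longlonglongrightarrow> 0"
    by (simp add: tendsto_rabs_zero_iff)
  then show "\<tau> \<longlonglongrightarrow> 0"
    by (rule LIMSEQ_imp_Suc)
qed

end
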